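(* Let $(p_n)_{n\ge2}$ and $(q_n)_{n\ge2}$ be real sequences with $0<q_n<p_n\le1$ such that for every $n\ge2$, $$p_nq_n([n]_{p_n,q_n}-1)>p_n^{n}(p_n-q_n).$$ Let $0<\rho\le1$, $M>0$, and let $L^*_n(f;p_n;q_n;x)$ be the King type modified $(p,q)$-Lupaş Bernstein operators defined in the context. Then for every $f\in\mathrm{Lip}_M(\rho)$, every $n\ge2$ and every $x\in[0,1]$, $$|L^*_n(f;p_n;q_n;x)-f(x)|\le M\,\delta_n(x)^{\rho},$$ where, writing $[m]=[m]_{p_n,q_n}$, $$\delta_n(x)=\sqrt{2x^2+x\left(\frac{p_n^n+x^2[n](p_n-q_n)}{2(p_n^{n-1}q_n-p_n^n+q_n^2[n-1])}-\frac{\sqrt{p_n^{2n}+x^4[n]^2(p_n-q_n)^2+2x^2[n]\left(2p_nq_n([n]-1)-p_n^n(p_n-q_n)\right)}}{2(p_n^{n-1}q_n-p_n^n+q_n^2[n-1])}\right)}.$$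
   Context: For $n\in\mathbb N$, $[n]_{p,q}=p^{n-1}+p^{n-2}q+\dots+pq^{n-2}+q^{n-1}$, $[0]_{p,q}=0$, $[n]_{p,q}!=[1]_{p,q}[2]_{p,q}\cdots[n]_{p,q}$, $[0]_{p,q}!=1$, and $\binom{n}{k}_{p,q}=\frac{[n]_{p,q}!}{[k]_{p,q}!\,[n-k]_{p,q}!}$ for $0\le k\le n$. For $n\ge2$ and $0<q<p\le1$ with $pq([n]_{p,q}-1)>p^n(p-q)$, writing $[m]=[m]_{p,q}$, put for $x\in[0,1]$ $$r_n(x)=\frac{-\left(p^n+x^2[n](p-q)\right)+\sqrt{p^{2n}+x^4[n]^2(p-q)^2+2x^2[n]\left(2pq([n]-1)-p^n(p-q)\right)}}{2\left(p^{n-1}q-p^n+q^2[n-1]\right)},$$ which satisfies $0\le r_n(x)\le 1$. For $f\in C[0,1]$ and $x\in[0,1]$, $$L^*_n(f;p;q;x)=\sum_{k=0}^n \frac{f\!\left(\frac{p^{n-k}[k]_{p,q}}{[n]_{p,q}}\right)\binom{n}{k}_{p,q}p^{\frac{(n-k)(n-k-1)}2}q^{\frac{k(k-1)}2}r_n(x)^k(1-r_n(x))^{n-k}}{\prod_{j=0}^{n-1}\{p^{j}(1-r_n(x))+q^{j}r_n(x)\}}.$$ When $p=p_n$, $q=q_n$, the function $r_n$ is formed with $p_n,q_n$. For $0<\rho\le1$ and $M>0$, $\mathrm{Lip}_M(\rho)$ is the set of $f\in C[0,1]$ with $|f(t)-f(x)|\le M|t-x|^\rho$ for all $t,x\in[0,1]$.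 *)

theory Defs
  imports Complex_Main
begin

definition pq_int :: "real \<Rightarrow> real \<Rightarrow> nat \<Rightarrow> real" where
  "pq_int p q n = (\<Sum>j<n. p ^ (n - 1 - j) * q ^ j)"

definition pq_fact :: "real \<Rightarrow> real \<Rightarrow> nat \<Rightarrow> real" where
  "pq_fact p q n = (\<Prod>m=1..n. pq_int p q m)"

text \<open>Meaningful for \<open>k \<le> n\<close> only: the subtraction is truncated.\<close>

definition pq_binomial :: "real \<Rightarrow> real \<Rightarrow> nat \<Rightarrow> nat \<Rightarrow> real" where
  "pq_binomial p q n k = pq_fact p q n / (pq_fact p q k * pq_fact p q (n - k))"

definition king_disc :: "real \<Rightarrow> real \<Rightarrow> nat \<Rightarrow> real \<Rightarrow> real" where
  "king_disc p q n x =
     p ^ (2 * n) + x ^ 4 * (pq_int p q n)\<^sup>2 * (p - q)\<^sup>2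
     + 2 * x\<^sup>2 * pq_int p q n * (2 * p * q * (pq_int p q n - 1) - p ^ n * (p - q))"

definition king_denom :: "real \<Rightarrow> real \<Rightarrow> nat \<Rightarrow> real" where
  "king_denom p q n = 2 * (p ^ (n - 1) * q - p ^ n + q\<^sup>2 * pq_int p q (n - 1))"

definition king_r :: "real \<Rightarrow> real \<Rightarrow> nat \<Rightarrow> real \<Rightarrow> real" where
  "king_r p q n x =
     (- (p ^ n + x\<^sup>2 * pq_int p q n * (p - q)) + sqrt (king_disc p q n x)) / king_denom p q n"

text \<open>The operator \<open>L\<^sup>*\<^sub>n(f;p;q;x)\<close>. The products halved by \<open>div\<close> are even,
  so the exponents are exact.\<close>

definition king_Lupas_Bernstein ::
  "nat \<Rightarrow> (real \<Rightarrow> real) \<Rightarrow> real \<Rightarrow> real \<Rightarrow> real \<Rightarrow> real" where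
  "king_Lupas_Bernstein n f p q x =
     (\<Sum>k=0..n.
        f (p ^ (n - k) * pq_int p q k / pq_int p q n)
        * pq_binomial p q n k
        * p ^ ((n - k) * (n - k - 1) div 2) * q ^ (k * (k - 1) div 2)
        * king_r p q n x ^ k * (1 - king_r p q n x) ^ (n - k)
        / (\<Prod>j<n. p ^ j * (1 - king_r p q n x) + q ^ j * king_r p q n x))"

text \<open>\<open>C[0,1]\<close> is represented by total functions that are continuous on \<open>{0..1}\<close>;
  their values elsewhere are irrelevant.\<close>

definition Lip :: "real \<Rightarrow> real \<Rightarrow> (real \<Rightarrow> real) set" where
  "Lip M \<rho> = {f. continuous_on {0..1} f \<and>
     (\<forall>t\<in>{0..1}. \<forall>x\<in>{0..1}. \<bar>f t - f x\<bar> \<le> M * \<bar>t - x\<bar> powr \<rho>)}"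

text \<open>The radicand of \<open>king_delta\<close> is \<open>2 x\<^sup>2 - x r\<^sub>n(x)\<close>, with the quotient
  \<open>r\<^sub>n(x)\<close> written out as a difference of two fractions.\<close>

definition king_delta :: "real \<Rightarrow> real \<Rightarrow> nat \<Rightarrow> real \<Rightarrow> real" where
  "king_delta p q n x =
     sqrt (2 * x\<^sup>2 + x *
       ((p ^ n + x\<^sup>2 * pq_int p q n * (p - q)) / king_denom p q n
        - sqrt (king_disc p q n x) / king_denom p q n))"

end

(* Write w_k for the weights of the operator, which are nonnegative and sum to 1 by the
   (p,q)-binomial theorem. The identity [k] binom(n,k) = [n] binom(n-1,k-1) gives the moments
     L(e_1) = r  and  L(e_2) = (r / [n]) (p^(n-1) + q^2 [n-1] r / (p (1 - r) + q r)).
   The discriminant in r_n(x) contains [n] - 1 where the equation L(e_2) = x^2 would require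
   [n] - p^(n-1). As p <= 1 this only makes r_n(x) smaller, so L(e_2) <= x^2 still holds.
   Hence L((t - x)^2) <= 2 x^2 - 2 x r <= 2 x^2 - x r = delta^2. Averaging the tangent-line bound
   |t - x|^rho <= delta^rho (1 + (rho / 2) ((t - x)^2 / delta^2 - 1)) gives the theorem. *)

theory Submission
  imports Defs "HOL-Analysis.Convex"
begin

section \<open>Arithmetic of (p,q)-integers\<close>

lemma pq_int_0 [simp]: "pq_int p q 0 = 0"
  by (simp add: pq_int_def)

lemma pq_int_Suc: "pq_int p q (Suc n) = p ^ n + q * pq_int p q n"
  unfolding pq_int_def
  by (simp add: sum.lessThan_Suc_shift sum_distrib_left mult.left_commute del: sum.lessThan_Suc)

text \<open>For \<open>m = n - k\<close> the first summand is the numerator of the k-th node and the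
  second is that of its complement to 1. Both the binomial theorem and the location of the nodes
  rest on this splitting.\<close>

lemma pq_int_add: "pq_int p q (m + k) = p ^ m * pq_int p q k + q ^ k * pq_int p q m"
proof (induction k)
  case 0
  then show ?case by simp
next
  case (Suc k)
  then show ?case by (simp add: pq_int_Suc power_add algebra_simps)
qed

section \<open>Weights and the (p,q)-binomial theorem\<close>

text \<open>The weight before normalisation, with independent \<open>y\<close> and \<open>z\<close>
  in place of \<open>r\<close> and \<open>1 - r\<close>: lowering the degree rescales them to
  \<open>q * y\<close> and \<open>p * z\<close>, whose sum need not be 1.\<close>

definition pq_term :: "real \<Rightarrow> real \<Rightarrow> nat \<Rightarrow> nat \<Rightarrow> real \<Rightarrow> real \<Rightarrow> real" where
  "pq_term p q n k y z =
     pq_binomial p q n k * p ^ ((n - k) choose 2) * q ^ (k choose 2) * y ^ k * z ^ (n - k)"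

lemma Suc_choose_two: "Suc k choose 2 = k + (k choose 2)"
  by (simp add: numeral_2_eq_2)

context
  fixes p q :: real
  assumes p_pos: "0 < p" and q_pos: "0 < q"
begin

lemma pq_int_nonneg: "0 \<le> pq_int p q n"
  using p_pos q_pos by (simp add: pq_int_def sum_nonneg)

lemma pq_int_Suc_pos: "0 < pq_int p q (Suc n)"
  using p_pos q_pos pq_int_nonneg[of n] by (simp add: pq_int_Suc add_pos_nonneg)

lemma pq_int_pos: "0 < n \<Longrightarrow> 0 < pq_int p q n"
  using pq_int_Suc_pos[of "n - 1"] by simp

lemma pq_fact_pos: "0 < pq_fact p q n"
  unfolding pq_fact_def using pq_int_pos by (auto intro!: prod_pos)

lemma pq_fact_Suc: "pq_fact p q (Suc n) = pq_fact p q n * pq_int p q (Suc n)"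
  by (simp add: pq_fact_def)

lemma pq_binomial_absorb:
  "pq_int p q (Suc k) * pq_binomial p q (Suc n) (Suc k) = pq_int p q (Suc n) * pq_binomial p q n k"
  using pq_int_Suc_pos[of k] by (simp add: pq_binomial_def pq_fact_Suc)

lemma pq_binomial_absorb_comp:
  assumes "k \<le> n"
  shows "pq_int p q (Suc (n - k)) * pq_binomial p q (Suc n) k
    = pq_int p q (Suc n) * pq_binomial p q n k"
  using pq_int_Suc_pos[of "n - k"] assms by (simp add: pq_binomial_def pq_fact_Suc Suc_diff_le)

lemma pq_term_nonneg: "0 \<le> y \<Longrightarrow> 0 \<le> z \<Longrightarrow> 0 \<le> pq_term p q n k y z"
  unfolding pq_term_def pq_binomial_def using p_pos q_pos
  by (simp add: pq_fact_pos less_imp_le)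

text \<open>The spare powers cause the rescaling: \<open>p ^ (n - k)\<close> joins
  \<open>z ^ (n - k)\<close>, and the \<open>q ^ k\<close> released by \<open>Suc k choose 2\<close>
  joins \<open>y ^ k\<close>.\<close>

lemma pq_term_absorb:
  assumes "k \<le> n"
  shows "p ^ (n - k) * pq_int p q (Suc k) * pq_term p q (Suc n) (Suc k) y z
    = pq_int p q (Suc n) * y * pq_term p q n k (q * y) (p * z)"
proof -
  have "p ^ (n - k) * pq_int p q (Suc k) * pq_term p q (Suc n) (Suc k) y z
    = (pq_int p q (Suc k) * pq_binomial p q (Suc n) (Suc k)) * (p ^ (n - k) * p ^ ((n - k) choose 2)
        * q ^ (Suc k choose 2) * y ^ Suc k * z ^ (n - k))"
    by (simp add: pq_term_def)
  then show ?thesis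
    unfolding pq_binomial_absorb
    by (simp add: pq_term_def Suc_choose_two power_add power_mult_distrib)
qed

text \<open>Mirror image: \<open>q ^ k\<close> is now supplied from outside and
  \<open>p ^ (n - k)\<close> is released by the exponent of \<open>p\<close>, so both rules end in
  the same rescaled term.\<close>

lemma pq_term_absorb_comp:
  assumes "k \<le> n"
  shows "q ^ k * pq_int p q (Suc n - k) * pq_term p q (Suc n) k y z
    = pq_int p q (Suc n) * z * pq_term p q n k (q * y) (p * z)"
proof -
  have "q ^ k * pq_int p q (Suc n - k) * pq_term p q (Suc n) k y z
    = (pq_int p q (Suc n - k) * pq_binomial p q (Suc n) k) * (q ^ k * p ^ ((Suc n - k) choose 2)
        * q ^ (k choose 2) * y ^ k * z ^ (Suc n - k))"
    by (simp add: pq_term_def)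
  then show ?thesis
    unfolding pq_binomial_absorb_comp[OF assms] Suc_diff_le[OF assms] Suc_choose_two power_add
    by (simp add: pq_term_def power_mult_distrib mult_ac)
qed

text \<open>The term at 0 vanishes because \<open>[0] = 0\<close>; the others are shifted and
  absorbed. The free factor \<open>g\<close> is 1 for the first moment and the node numerator for
  the second.\<close>

lemma sum_node_pq_term:
  "(\<Sum>k\<le>Suc n. g k * (p ^ (Suc n - k) * pq_int p q k) * pq_term p q (Suc n) k y z)
    = pq_int p q (Suc n) * y * (\<Sum>k\<le>n. g (Suc k) * pq_term p q n k (q * y) (p * z))"
proof -
  have "(\<Sum>k\<le>Suc n. g k * (p ^ (Suc n - k) * pq_int p q k) * pq_term p q (Suc n) k y z)
    = (\<Sum>k\<le>n. g (Suc k) * (p ^ (n - k) * pq_int p q (Suc k) * pq_term p q (Suc n) (Suc k) y z))"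
    by (simp add: sum.atMost_Suc_shift mult.assoc del: sum.atMost_Suc)
  also have "\<dots> = (\<Sum>k\<le>n. g (Suc k) * (pq_int p q (Suc n) * y * pq_term p q n k (q * y) (p * z)))"
    by (intro sum.cong) (auto simp: pq_term_absorb)
  finally show ?thesis
    by (simp add: sum_distrib_left mult_ac)
qed

text \<open>Multiply by \<open>[n + 1]\<close> and split it by \<open>pq_int_add\<close> in each
  term. The two absorption rules send the halves to the same sum, with factors \<open>y\<close> and
  \<open>z\<close>.\<close>

lemma sum_pq_term_Suc:
  "(\<Sum>k\<le>Suc n. pq_term p q (Suc n) k y z) = (y + z) * (\<Sum>k\<le>n. pq_term p q n k (q * y) (p * z))"
    (is "?S = (y + z) * ?R")
proof -
  let ?N = "pq_int p q (Suc n)" and ?T = "\<lambda>k. pq_term p q (Suc n) k y z"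
  have split: "?N = p ^ (Suc n - k) * pq_int p q k + q ^ k * pq_int p q (Suc n - k)"
    if "k \<le> Suc n" for k
    using pq_int_add[of p q "Suc n - k" k] that by simp
  have "?N * ?S = (\<Sum>k\<le>Suc n. (p ^ (Suc n - k) * pq_int p q k
      + q ^ k * pq_int p q (Suc n - k)) * ?T k)"
    unfolding sum_distrib_left by (rule sum.cong) (auto simp: split[symmetric])
  also have "\<dots> = (\<Sum>k\<le>Suc n. 1 * (p ^ (Suc n - k) * pq_int p q k) * ?T k)
      + (\<Sum>k\<le>Suc n. q ^ k * pq_int p q (Suc n - k) * ?T k)"
    by (simp add: distrib_right sum.distrib)
  also have "(\<Sum>k\<le>Suc n. 1 * (p ^ (Suc n - k) * pq_int p q k) * ?T k) = ?N * y * ?R"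
    by (subst sum_node_pq_term) simp
  \<comment> \<open>The last index drops out, its factor being \<open>[0] = 0\<close>.\<close>
  also have "(\<Sum>k\<le>Suc n. q ^ k * pq_int p q (Suc n - k) * ?T k)
      = (\<Sum>k\<le>n. q ^ k * pq_int p q (Suc n - k) * ?T k)"
    by simp
  also have "\<dots> = (\<Sum>k\<le>n. ?N * z * pq_term p q n k (q * y) (p * z))"
    by (intro sum.cong refl pq_term_absorb_comp) simp
  also have "\<dots> = ?N * z * ?R"
    by (simp add: sum_distrib_left)
  finally have "?N * ?S = ?N * ((y + z) * ?R)"
    by (simp add: algebra_simps)
  then show ?thesis
    using pq_int_Suc_pos[of n] by simp
qed

text \<open>Rescaling turns the factor of index j into that of index j + 1, so each step splits off
  the factor of index 0. The hypothesis is applied at \<open>q * y\<close> and \<open>p * z\<close>,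
  hence the generalisation.\<close>

theorem pq_binomial_theorem:
  "(\<Sum>k\<le>n. pq_term p q n k y z) = (\<Prod>j<n. p ^ j * z + q ^ j * y)"
proof (induction n arbitrary: y z)
  case 0
  show ?case by (simp add: pq_term_def pq_binomial_def pq_fact_def numeral_2_eq_2)
next
  case (Suc n)
  show ?case
    unfolding sum_pq_term_Suc Suc.IH prod.lessThan_Suc_shift
    by (simp add: mult_ac add.commute)
qed

section \<open>Second moment and location of the nodes\<close>

text \<open>One node factor is absorbed; the other becomes a constant \<open>p ^ Suc l\<close> plus
  \<open>q\<close> times a node numerator of lower degree. The resulting total mass and first moment
  of degree \<open>Suc l\<close> both reduce to the same sum of degree \<open>l\<close>.\<close>

lemma sum_node_sq_pq_term:
  "(\<Sum>k\<le>Suc (Suc l). (p ^ (Suc (Suc l) - k) * pq_int p q k)\<^sup>2 * pq_term p q (Suc (Suc l)) k y z)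
    = pq_int p q (Suc (Suc l)) * y
      * (p ^ Suc l * (q * y + p * z) + q\<^sup>2 * pq_int p q (Suc l) * y)
      * (\<Sum>k\<le>l. pq_term p q l k (q * (q * y)) (p * (p * z)))"
    (is "_ = ?N * y * _ * ?R")
proof -
  let ?m = "Suc l"
  let ?T = "\<lambda>k. pq_term p q ?m k (q * y) (p * z)"
  have "(\<Sum>k\<le>Suc ?m. (p ^ (Suc ?m - k) * pq_int p q k)\<^sup>2 * pq_term p q (Suc ?m) k y z)
      = ?N * y * (\<Sum>k\<le>?m. p ^ (?m - k) * pq_int p q (Suc k) * ?T k)"
    using sum_node_pq_term[of "\<lambda>k. p ^ (Suc ?m - k) * pq_int p q k" ?m y z]
    by (simp only: power2_eq_square diff_Suc_Suc)
  also have "(\<Sum>k\<le>?m. p ^ (?m - k) * pq_int p q (Suc k) * ?T k)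
      = (\<Sum>k\<le>?m. p ^ ?m * ?T k + q * (1 * (p ^ (?m - k) * pq_int p q k) * ?T k))"
  proof (rule sum.cong)
    fix k assume "k \<in> {..?m}"
    then have "p ^ (?m - k) * p ^ k = p ^ ?m"
      by (simp flip: power_add)
    then have "p ^ (?m - k) * pq_int p q (Suc k)
        = p ^ ?m + q * (p ^ (?m - k) * pq_int p q k)"
      by (simp add: pq_int_Suc distrib_left mult.left_commute)
    then show "p ^ (?m - k) * pq_int p q (Suc k) * ?T k
        = p ^ ?m * ?T k + q * (1 * (p ^ (?m - k) * pq_int p q k) * ?T k)"
      by (simp only:) (simp add: algebra_simps)
  qed simp
  also have "\<dots> = p ^ ?m * (\<Sum>k\<le>?m. ?T k)
      + q * (\<Sum>k\<le>?m. 1 * (p ^ (?m - k) * pq_int p q k) * ?T k)"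
    by (simp only: sum.distrib sum_distrib_left)
  also have "\<dots> = p ^ ?m * ((q * y + p * z) * ?R) + q * (pq_int p q ?m * (q * y) * ?R)"
    unfolding sum_pq_term_Suc sum_node_pq_term by simp
  finally show ?thesis
    by (simp only:) (simp add: algebra_simps power2_eq_square)
qed

lemma node_in_unit:
  assumes "0 < n" "k \<le> n"
  shows "p ^ (n - k) * pq_int p q k / pq_int p q n \<in> {0..1}"
proof -
  have "pq_int p q n = p ^ (n - k) * pq_int p q k + q ^ k * pq_int p q (n - k)"
    using pq_int_add[of p q "n - k" k] assms by simp
  moreover have "0 \<le> p ^ (n - k) * pq_int p q k" "0 \<le> q ^ k * pq_int p q (n - k)"
    using p_pos q_pos by (simp_all add: pq_int_nonneg)
  ultimately show ?thesis
    using pq_int_pos[of n] assms by (simp add: divide_le_eq)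
qed

end

section \<open>Bounds on r_n(x) and its quadratic inequality\<close>

text \<open>In the notation of the proof, \<open>r\<close> is the nonnegative root of
  \<open>A * r^2 + B * r = x^2 * a * K / A\<close> with
  \<open>K = p * q * (a - 1) - p * c * (p - q)\<close>. Since \<open>K <= p * A\<close>, the right
  side is at most \<open>x^2 * a * p\<close>; this rearranges to the third claim, which is L(e_2) <=
  x^2 cleared of denominators.\<close>

lemma king_r_bounds:
  fixes p q x :: real
  assumes "0 < q" "q < p" "p \<le> 1" "0 < n"
    and cond: "p * q * (pq_int p q n - 1) > p ^ n * (p - q)"
    and "0 \<le> x" "x \<le> 1"
  shows "0 \<le> king_r p q n x" "king_r p q n x \<le> 1"
    and "q\<^sup>2 * pq_int p q (n - 1) * (king_r p q n x)\<^sup>2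
        + p ^ (n - 1) * king_r p q n x * (p * (1 - king_r p q n x) + q * king_r p q n x)
      \<le> x\<^sup>2 * pq_int p q n * (p * (1 - king_r p q n x) + q * king_r p q n x)"
proof -
  obtain m where n: "n = Suc m"
    using \<open>0 < n\<close> gr0_conv_Suc by blast
  define r where "r = king_r p q n x"
  define a b c where "a = pq_int p q n" and "b = pq_int p q m" and "c = p ^ m"
  define A B where "A = c * q - p * c + q\<^sup>2 * b" and "B = p * c + x\<^sup>2 * a * (p - q)"
  define s where "s = sqrt (king_disc p q n x)"
  have a: "a = c + q * b"
    by (simp add: a_def b_def c_def n pq_int_Suc)
  have c: "0 < c" "c \<le> 1"
    using assms by (auto simp: c_def power_le_one)
  have "0 < p"
    using assms by simp
  have a0: "0 < a"
    using pq_int_pos[of p q n] assms \<open>0 < p\<close> by (simp add: a_def)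
  have hyp: "p * q * (a - 1) > p * c * (p - q)"
    using cond by (simp add: a_def c_def n)
  \<comment> \<open>Replacing \<open>c\<close> by 1 gives the quantity assumed positive, and
    \<open>c <= 1\<close>; so the denominator \<open>2 * A\<close> of \<open>r\<close> is
    positive.\<close>
  have "p * A = p * q * (a - c) - p * c * (p - q)"
    by (simp add: A_def a algebra_simps power2_eq_square)
  also have "\<dots> \<ge> p * q * (a - 1) - p * c * (p - q)"
    using c assms \<open>0 < p\<close> by (simp add: mult_left_mono)
  finally have pA: "p * q * (a - 1) - p * c * (p - q) \<le> p * A" .
  then have "0 < p * A"
    using hyp by simp
  then have A0: "0 < A"
    using \<open>0 < p\<close> by (simp add: zero_less_mult_iff)
  have x2: "0 \<le> x\<^sup>2" "x\<^sup>2 \<le> 1"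
    using assms by (auto simp: power_le_one)
  have B0: "0 \<le> B"
    using x2 a0 c assms \<open>0 < p\<close> by (simp add: B_def)
  have disc: "king_disc p q n x
      = B\<^sup>2 + 4 * (x\<^sup>2 * a) * (p * q * (a - 1) - p * c * (p - q))"
    unfolding king_disc_def a_def[symmetric] B_def
    by (simp add: c_def n power_mult power2_eq_square
        algebra_simps power4_eq_xxxx)
  have disc_ge: "B\<^sup>2 \<le> king_disc p q n x"
    using disc hyp x2 a0 by simp
  have "x\<^sup>2 * a * (p * q * (a - 1) - p * c * (p - q)) \<le> x\<^sup>2 * a * (p * A)"
    using x2 a0 pA by (intro mult_left_mono) auto
  then have disc_le: "king_disc p q n x \<le> B\<^sup>2 + 4 * A * (x\<^sup>2 * a * p)"
    unfolding disc by (simp add: mult_ac)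
  have s: "B \<le> s" "s\<^sup>2 = king_disc p q n x"
    using disc_ge B0 order_trans[OF zero_le_power2 disc_ge] by (auto simp: s_def intro: real_le_rsqrt)
  have "r = (- B + s) / (2 * A)"
    by (simp add: r_def king_r_def king_denom_def s_def A_def B_def a_def b_def c_def n mult_ac)
  then have rs: "2 * A * r + B = s"
    using A0 by (simp add: field_simps)
  show "0 \<le> king_r p q n x"
    using s rs A0 by (simp flip: r_def add: zero_le_mult_iff) (smt (verit) mult_pos_neg)
  \<comment> \<open>This is \<open>A * r^2 + B * r - x^2 * a * p\<close> evaluated at
    \<open>r = 1\<close>. Its nonnegativity bounds the discriminant by \<open>(2 * A + B)^2\<close>,
    hence \<open>r <= 1\<close>.\<close>
  have quad: "A + B - x\<^sup>2 * a * p = q * a * (1 - x\<^sup>2)"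
    by (simp add: A_def B_def a algebra_simps power2_eq_square)
  then have "x\<^sup>2 * a * p \<le> A + B"
    using x2 a0 assms by (smt (verit) mult_nonneg_nonneg)
  then have "4 * A * (x\<^sup>2 * a * p) \<le> 4 * A * (A + B)"
    using A0 by (intro mult_left_mono) auto
  then have "s\<^sup>2 \<le> (2 * A + B)\<^sup>2"
    using s disc_le by (simp add: power2_eq_square algebra_simps)
  then have "s \<le> 2 * A + B"
    by (rule power2_le_imp_le) (use A0 B0 in simp)
  then have "A * r \<le> A * 1"
    using rs by simp
  then show "king_r p q n x \<le> 1"
    using A0 by (simp flip: r_def)
  have "(2 * A * r + B)\<^sup>2 \<le> B\<^sup>2 + 4 * A * (x\<^sup>2 * a * p)"
    using s disc_le rs by simp
  then have "A * (A * r\<^sup>2 + B * r) \<le> A * (x\<^sup>2 * a * p)"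
    by (simp add: power2_eq_square algebra_simps)
  then have "A * r\<^sup>2 + B * r \<le> x\<^sup>2 * a * p"
    using A0 by simp
  \<comment> \<open>Expand \<open>A\<close> and \<open>B\<close> and move
    \<open>x^2 * a * (p - q) * r\<close> to the right.\<close>
  then have "q\<^sup>2 * b * r\<^sup>2 + c * r * (p * (1 - r) + q * r) \<le> x\<^sup>2 * a * (p * (1 - r) + q * r)"
    by (simp add: A_def B_def power2_eq_square algebra_simps)
  then show "q\<^sup>2 * pq_int p q (n - 1) * (king_r p q n x)\<^sup>2
        + p ^ (n - 1) * king_r p q n x * (p * (1 - king_r p q n x) + q * king_r p q n x)
      \<le> x\<^sup>2 * pq_int p q n * (p * (1 - king_r p q n x) + q * king_r p q n x)"
    by (simp add: r_def a_def b_def c_def n)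
qed

section \<open>Fractional moments and averages of Lipschitz functions\<close>

text \<open>Weighted AM-GM for \<open>u\<close> and 1 with weights \<open>\<alpha>\<close> and
  \<open>1 - \<alpha>\<close>.\<close>

lemma powr_le_tangent:
  fixes u \<alpha> :: real
  assumes "0 \<le> u" "0 < \<alpha>" "\<alpha> \<le> 1"
  shows "u powr \<alpha> \<le> 1 + \<alpha> * (u - 1)"
proof (cases "u = 0")
  case False
  have "u powr \<alpha> * 1 powr (1 - \<alpha>) \<le> \<alpha> * u + (1 - \<alpha>) * 1"
    using assms False by (intro Youngs_inequality_0) auto
  then show ?thesis
    by (simp add: algebra_simps)
qed (use assms in simp)

lemma sum_powr_le_of_second_moment:
  fixes w t :: "'a \<Rightarrow> real"
  assumes "finite K" and w: "\<And>k. k \<in> K \<Longrightarrow> 0 \<le> w k" and "sum w K = 1"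
    and mom: "(\<Sum>k\<in>K. w k * (t k)\<^sup>2) \<le> d\<^sup>2" and "0 \<le> d" and \<rho>: "0 < \<rho>" "\<rho> \<le> 1"
  shows "(\<Sum>k\<in>K. w k * \<bar>t k\<bar> powr \<rho>) \<le> d powr \<rho>"
proof (cases "d = 0")
  \<comment> \<open>The tangent bound divides by \<open>d\<close>. For \<open>d = 0\<close>, as
    happens at \<open>x = 0\<close>, every \<open>w k * (t k)^2\<close> vanishes, so each summand
    does, because \<open>0 powr \<rho> = 0\<close>.\<close>
  case True
  have nn: "0 \<le> w k * (t k)\<^sup>2" if "k \<in> K" for k
    using w that by simp
  then have "(\<Sum>k\<in>K. w k * (t k)\<^sup>2) = 0"
    using mom True by (intro antisym sum_nonneg) auto
  then have "\<forall>k\<in>K. w k * (t k)\<^sup>2 = 0"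
    using sum_nonneg_eq_0_iff[OF \<open>finite K\<close> nn] by simp
  then show ?thesis
    using True by (auto intro!: sum_nonpos)
next
  case False
  then have d: "0 < d"
    using assms by simp
  \<comment> \<open>Tangent at \<open>s = d^2\<close> to the concave map
    \<open>s powr (\<rho> / 2)\<close>, taken at \<open>s = (t k)^2\<close>.\<close>
  have tangent: "\<bar>t k\<bar> powr \<rho> \<le> d powr \<rho> * (1 + \<rho> / 2 * ((t k)\<^sup>2 / d\<^sup>2 - 1))" for k
  proof -
    have "(\<bar>t k\<bar> / d) powr \<rho> = ((\<bar>t k\<bar> / d) powr 2) powr (\<rho> / 2)"
      by (simp add: powr_powr)
    also have "(\<bar>t k\<bar> / d) powr 2 = (t k)\<^sup>2 / d\<^sup>2"
      using d by (simp add: power_divide)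
    also have "((t k)\<^sup>2 / d\<^sup>2) powr (\<rho> / 2) \<le> 1 + \<rho> / 2 * ((t k)\<^sup>2 / d\<^sup>2 - 1)"
      using \<rho> by (intro powr_le_tangent) auto
    finally show ?thesis
      using d by (simp add: powr_divide field_simps)
  qed
  have "(\<Sum>k\<in>K. w k * \<bar>t k\<bar> powr \<rho>)
      \<le> (\<Sum>k\<in>K. w k * (d powr \<rho> * (1 + \<rho> / 2 * ((t k)\<^sup>2 / d\<^sup>2 - 1))))"
    by (intro sum_mono mult_left_mono tangent w)
  also have "\<dots> = (\<Sum>k\<in>K. d powr \<rho> * (1 - \<rho> / 2) * w k + d powr \<rho> * (\<rho> / 2) / d\<^sup>2 * (w k * (t k)\<^sup>2))"
    by (intro sum.cong) (auto simp: algebra_simps)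
  also have "\<dots> = d powr \<rho> * (1 - \<rho> / 2) + d powr \<rho> * (\<rho> / 2) / d\<^sup>2 * (\<Sum>k\<in>K. w k * (t k)\<^sup>2)"
    unfolding sum.distrib sum_distrib_left[symmetric] \<open>sum w K = 1\<close> by simp
  also have "\<dots> \<le> d powr \<rho> * (1 - \<rho> / 2) + d powr \<rho> * (\<rho> / 2) / d\<^sup>2 * d\<^sup>2"
    using mom \<rho> by (intro add_left_mono mult_left_mono) auto
  also have "\<dots> = d powr \<rho>"
    using d by (simp add: algebra_simps)
  finally show ?thesis .
qed

text \<open>Because the weights sum to 1, \<open>f x\<close> can be moved inside the sum; the
  Lipschitz bound then leaves a fractional moment.\<close>

lemma Lip_average_error:
  assumes f: "f \<in> Lip M \<rho>" and "finite K"
    and w: "\<And>k. k \<in> K \<Longrightarrow> 0 \<le> w k" and sum1: "sum w K = 1"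
    and t: "\<And>k. k \<in> K \<Longrightarrow> t k \<in> {0..1}" and x: "x \<in> {0..1}"
    and mom: "(\<Sum>k\<in>K. w k * (t k - x)\<^sup>2) \<le> d\<^sup>2" and "0 \<le> d"
    and "0 < \<rho>" "\<rho> \<le> 1" "0 \<le> M"
  shows "\<bar>(\<Sum>k\<in>K. w k * f (t k)) - f x\<bar> \<le> M * d powr \<rho>"
proof -
  have "(\<Sum>k\<in>K. w k * f (t k)) - f x = (\<Sum>k\<in>K. w k * (f (t k) - f x))"
    by (simp add: right_diff_distrib sum_subtractf sum1 flip: sum_distrib_right)
  also have "\<bar>\<dots>\<bar> \<le> (\<Sum>k\<in>K. \<bar>w k * (f (t k) - f x)\<bar>)"
    by (rule sum_abs)
  also have "\<dots> \<le> (\<Sum>k\<in>K. w k * (M * \<bar>t k - x\<bar> powr \<rho>))"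
    using f t x w by (intro sum_mono) (simp add: abs_mult Lip_def mult_left_mono)
  also have "\<dots> = M * (\<Sum>k\<in>K. w k * \<bar>t k - x\<bar> powr \<rho>)"
    by (simp add: sum_distrib_left mult.left_commute)
  also have "\<dots> \<le> M * d powr \<rho>"
    using assms by (intro mult_left_mono sum_powr_le_of_second_moment) auto
  finally show ?thesis .
qed

section \<open>Moments of the operator and the estimate for a single n\<close>

lemma king_Lupas_Bernstein_Lip:
  fixes p q x :: real
  assumes q0: "0 < q" and qp: "q < p" and p1: "p \<le> 1" and n2: "2 \<le> n"
    and cond: "p * q * (pq_int p q n - 1) > p ^ n * (p - q)"
    and "0 < \<rho>" "\<rho> \<le> 1" "0 \<le> M"
    and f: "f \<in> Lip M \<rho>" and x: "x \<in> {0..1}"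
  shows "\<bar>king_Lupas_Bernstein n f p q x - f x\<bar> \<le> M * king_delta p q n x powr \<rho>"
proof -
  have p0: "0 < p"
    using q0 qp by simp
  \<comment> \<open>The second moment lowers the degree twice.\<close>
  obtain l where n: "n = Suc (Suc l)"
    using n2 by (metis Suc_le_D numeral_2_eq_2 Suc_le_mono)
  define r where "r = king_r p q n x"
  have "0 < n" "0 \<le> x" "x \<le> 1"
    using n2 x by auto
  note r_bounds = king_r_bounds[OF q0 qp p1 \<open>0 < n\<close> cond \<open>0 \<le> x\<close> \<open>x \<le> 1\<close>, folded r_def]
  define P where "P = (\<Prod>j<n. p ^ j * (1 - r) + q ^ j * r)"
  define w where "w k = pq_term p q n k r (1 - r) / P" for k
  define t where "t k = p ^ (n - k) * pq_int p q k / pq_int p q n" for k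
  \<comment> \<open>In the product \<open>P\<close> the factor of index 0 is 1, \<open>D\<close> is
    the factor of index 1, and \<open>R\<close> is the product of the remaining ones, so
    \<open>P = D * R\<close>.\<close>
  define R where "R = (\<Sum>k\<le>l. pq_term p q l k (q * (q * r)) (p * (p * (1 - r))))"
  define D where "D = p * (1 - r) + q * r"
  define N where "N = pq_int p q n"
  have N0: "0 < N"
    using pq_int_pos[OF p0 q0 \<open>0 < n\<close>] by (simp add: N_def)
  have factor_pos: "0 < p ^ j * (1 - r) + q ^ j * r" for j
    using r_bounds(1,2) p0 q0 by (cases "r = 1") (auto intro: add_pos_nonneg)
  then have P0: "0 < P"
    by (simp add: P_def prod_pos)
  have D0: "0 < D"
    using factor_pos[of 1] by (simp add: D_def)
  have sumT: "(\<Sum>k\<le>n. pq_term p q n k r (1 - r)) = P"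
    by (simp only: P_def pq_binomial_theorem[OF p0 q0])
  have P_eq: "P = D * R"
    unfolding sumT[symmetric] n sum_pq_term_Suc[OF p0 q0] by (simp add: D_def R_def)
  have R0: "0 < R"
    using P0 D0 by (simp add: P_eq zero_less_mult_iff)
  have w_nonneg: "0 \<le> w k" for k
    using P0 r_bounds(1,2) by (simp add: w_def pq_term_nonneg[OF p0 q0])
  have w_sum: "(\<Sum>k\<le>n. w k) = 1"
    using P0 by (simp add: w_def sumT flip: sum_divide_distrib)
  have m1: "(\<Sum>k\<le>n. w k * t k) = r"
  proof -
    have "(\<Sum>k\<le>n. w k * t k) = (\<Sum>k\<le>n. 1 * (p ^ (n - k) * pq_int p q k)
        * pq_term p q n k r (1 - r)) / (N * P)"
      by (simp add: w_def t_def N_def sum_divide_distrib mult_ac)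
    also have "\<dots> = (N * r * (D * R)) / (N * P)"
      unfolding n sum_node_pq_term[OF p0 q0] N_def
      by (simp add: sum_pq_term_Suc[OF p0 q0] D_def R_def add.commute del: sum.atMost_Suc)
    also have "\<dots> = r"
      using N0 P0 by (simp flip: P_eq)
    finally show ?thesis .
  qed
  have m2: "(\<Sum>k\<le>n. w k * (t k)\<^sup>2) \<le> x\<^sup>2"
  proof -
    define E where "E = p ^ (n - 1) * D + q\<^sup>2 * pq_int p q (n - 1) * r"
    have "(\<Sum>k\<le>n. w k * (t k)\<^sup>2) = (\<Sum>k\<le>n. (p ^ (n - k) * pq_int p q k)\<^sup>2
        * pq_term p q n k r (1 - r)) / (N\<^sup>2 * P)"
      by (simp add: w_def t_def N_def sum_divide_distrib power_divide mult_ac)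
    also have "\<dots> = (N * r * E * R) / (N\<^sup>2 * P)"
      unfolding n sum_node_sq_pq_term[OF p0 q0] N_def
      by (simp add: E_def D_def R_def n add.commute)
    also have "\<dots> = r * E / (N * D)"
      using N0 R0 by (simp add: P_eq power2_eq_square)
    \<comment> \<open>The third bound on \<open>r\<close>, divided by \<open>N * D\<close>.\<close>
    also have "\<dots> \<le> x\<^sup>2"
      using r_bounds(3)[folded D_def N_def] N0 D0
      by (simp add: divide_le_eq E_def power2_eq_square algebra_simps)
    finally show ?thesis .
  qed
  have "(\<Sum>k\<le>n. w k * (t k - x)\<^sup>2)
      = (\<Sum>k\<le>n. w k * (t k)\<^sup>2 + (x\<^sup>2 * w k - 2 * x * (w k * t k)))"
    by (intro sum.cong) (auto simp: power2_eq_square algebra_simps)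
  also have "\<dots> = (\<Sum>k\<le>n. w k * (t k)\<^sup>2) + (x\<^sup>2 - 2 * x * r)"
    unfolding sum.distrib sum_subtractf sum_distrib_left[symmetric] m1 w_sum by simp
  also have "\<dots> \<le> 2 * x\<^sup>2 - 2 * x * r"
    using m2 by simp
  also have "\<dots> \<le> 2 * x\<^sup>2 - x * r"
    using r_bounds(1) \<open>0 \<le> x\<close> by simp
  finally have mom: "(\<Sum>k\<le>n. w k * (t k - x)\<^sup>2) \<le> 2 * x\<^sup>2 - x * r" .
  \<comment> \<open>The radicand dominates a sum of nonnegative terms, so the square of
    \<open>king_delta\<close> really is the radicand.\<close>
  moreover have "0 \<le> (\<Sum>k\<le>n. w k * (t k - x)\<^sup>2)"
    by (simp add: sum_nonneg w_nonneg)
  ultimately have rad: "0 \<le> 2 * x\<^sup>2 - x * r"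
    by linarith
  have delta: "king_delta p q n x = sqrt (2 * x\<^sup>2 - x * r)"
    by (simp add: king_delta_def r_def king_r_def diff_divide_distrib add_divide_distrib algebra_simps)
  \<comment> \<open>\<open>choose_two\<close> matches the halved products in the exponents with
    those of \<open>pq_term\<close>; the sums then agree term by term.\<close>
  have L: "king_Lupas_Bernstein n f p q x = (\<Sum>k\<le>n. w k * f (t k))"
    unfolding king_Lupas_Bernstein_def r_def[symmetric] P_def[symmetric]
    by (simp add: w_def t_def pq_term_def choose_two atMost_atLeast0 mult_ac)
  show ?thesis
    unfolding L delta
    using assms w_nonneg w_sum mom rad node_in_unit[OF p0 q0 \<open>0 < n\<close>]
    by (intro Lip_average_error[OF f]) (auto simp: t_def)
qed

theorem theorem3p3:
  fixes p q :: "nat \<Rightarrow> real" and \<rho> M :: real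
  assumes "\<And>n. n \<ge> 2 \<Longrightarrow> 0 < q n \<and> q n < p n \<and> p n \<le> 1"
    and "\<And>n. n \<ge> 2 \<Longrightarrow>
           p n * q n * (pq_int (p n) (q n) n - 1) > p n ^ n * (p n - q n)"
    and "0 < \<rho>" and "\<rho> \<le> 1" and "M > 0"
  shows "\<forall>f\<in>Lip M \<rho>. \<forall>n\<ge>2. \<forall>x\<in>{0..1}.
           \<bar>king_Lupas_Bernstein n f (p n) (q n) x - f x\<bar>
             \<le> M * king_delta (p n) (q n) n x powr \<rho>"
  using assms by (auto intro!: king_Lupas_Bernstein_Lip)

end
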